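(* Assume either $k\le O(\sqrt n)$ and $|\Sigma|\ge 2$, or $k\le O(n)$ and $|\Sigma|\ge 2n$. Then any public-coin simultaneous sketching protocol which, for strings $x,y\in\Sigma^n$ with $\mathsf{ed}(x,y)\le k$, lets the referee compute $\mathsf{ed}(x,y)$ (without necessarily an edit sequence) with probability at least $2/3$ must have sketch size $\Omega(k)$ bits.
   Context: $\mathsf{ed}(x,y)$ denotes edit distance (minimum number of insertions, deletions and substitutions). In a simultaneous sketching protocol, Alice (holding $x$) and Bob (holding $y$) share public randomness with a referee; each sends one message (sketch) to the referee, who must produce the output from the two sketches and the public randomness. The sketch size is the maximum length of the sketches. *)

theory Defs
  imports "HOL-Probability.Probability" "HOL-Library.NList"
begin

inductive edit_step :: "'a list \<Rightarrow> 'a list \<Rightarrow> bool" where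
  insertion: "edit_step (u @ v) (u @ [a] @ v)"
| deletion: "edit_step (u @ [a] @ v) (u @ v)"
| substitution: "edit_step (u @ [a] @ v) (u @ [b] @ v)"

definition ed :: "'a list \<Rightarrow> 'a list \<Rightarrow> nat" where
  "ed x y = (LEAST m. (edit_step ^^ m) x y)"

text \<open>The minimum is taken over a nonempty set: delete all of \<open>x\<close>, then insert all of \<open>y\<close>.\<close>

lemma edit_steps_exist: "\<exists>m. (edit_step ^^ m) x y"
proof -
  have del: "edit_step\<^sup>*\<^sup>* z []" for z :: "'a list"
  proof (induction z)
    case (Cons a z)
    have "edit_step (a # z) z" using edit_step.deletion[of "[]" a z] by simp
    then show ?case using Cons.IH by (rule converse_rtranclp_into_rtranclp)
  qed simp
  have ins: "edit_step\<^sup>*\<^sup>* [] z" for z :: "'a list"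
  proof (induction z)
    case (Cons a z)
    have "edit_step z (a # z)" using edit_step.insertion[of "[]" z a] by simp
    with Cons.IH show ?case by (rule rtranclp.rtrancl_into_rtrancl)
  qed simp
  have "edit_step\<^sup>*\<^sup>* x y" using del ins by (rule rtranclp_trans)
  then show ?thesis by (simp add: rtranclp_power)
qed

text \<open>
  The public randomness is an arbitrary probability space. Alice, Bob and the referee all see its
  outcome \<open>r\<close>; apart from \<open>r\<close>, the referee sees only the two sketches. Private coins need no
  separate treatment, since they can be made components of \<open>r\<close>.
\<close>

record ('r, 'a) sketch_protocol =
  coins :: "'r measure"
  alice :: "'r \<Rightarrow> 'a list \<Rightarrow> bool list"
  bob :: "'r \<Rightarrow> 'a list \<Rightarrow> bool list"
  referee :: "'r \<Rightarrow> bool list \<Rightarrow> bool list \<Rightarrow> nat"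

text \<open>
  Nothing is required of the referee when the edit distance exceeds \<open>k\<close>. The success event is
  automatically measurable, because the measure of a non-measurable set is \<open>0\<close>.
\<close>

definition computes_ed ::
  "('r, 'a) sketch_protocol \<Rightarrow> 'a set \<Rightarrow> nat \<Rightarrow> nat \<Rightarrow> bool" where
  "computes_ed P \<Sigma> n k \<longleftrightarrow>
     prob_space (coins P) \<and>
     (\<forall>x\<in>nlists n \<Sigma>. \<forall>y\<in>nlists n \<Sigma>. ed x y \<le> k \<longrightarrow>
        \<P>(r in coins P. referee P r (alice P r x) (bob P r y) = ed x y) \<ge> 2 / 3)"

text \<open>The value is \<open>\<infinity>\<close> if the sketches have unbounded length.\<close>

definition sketch_size :: "('r, 'a) sketch_protocol \<Rightarrow> 'a set \<Rightarrow> nat \<Rightarrow> enat" where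
  "sketch_size P \<Sigma> n =
     (SUP r\<in>space (coins P). SUP x\<in>nlists n \<Sigma>.
        max (enat (length (alice P r x))) (enat (length (bob P r x))))"

end

theory Submission
  imports Defs
begin

text \<open>
  The proof reduces the one-way index problem. Alice encodes \<open>x \<subseteq> {..<m}\<close> as a two-letter string
  with exactly \<open>m\<close> occurrences of \<open>a\<close>, at the positions \<open>i \<in> x\<close> and \<open>m + i\<close> for \<open>i \<notin> x\<close>; Bob encodes an
  index \<open>i\<close> as the string whose only \<open>a\<close> is at position \<open>i\<close>. Each edit step removes at most one \<open>a\<close>,
  so the distance is at least \<open>m - 1\<close>; since the strings have equal length, it is \<open>m - 1\<close> only if all
  steps are substitutions, that is, only if \<open>i \<in> x\<close>. Otherwise it is at most \<open>m + 1 \<le> k\<close>. Hence the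
  referee reads off each bit of \<open>x\<close> from Alice's sketch. The strings need length only \<open>2 m\<close>, so two
  letters suffice even for \<open>k\<close> linear in \<open>n\<close>.
\<close>

section \<open>Edit steps, Hamming distance and letter counts\<close>

lemma ed_steps: "(edit_step ^^ ed x y) x y"
  unfolding ed_def by (rule LeastI_ex) (rule edit_steps_exist)

lemma ed_le: "(edit_step ^^ m) x y \<Longrightarrow> ed x y \<le> m"
  unfolding ed_def by (rule Least_le)

lemma ed_self [simp]: "ed x x = 0"
  using ed_le[of 0 x x] by simp

lemma edit_step_list_update:
  assumes "p < length x"
  shows "edit_step x (x[p := c])"
  using edit_step.substitution[of "take p x" "x ! p" "drop (Suc p) x" c] assms
  by (simp add: id_take_nth_drop[symmetric] upd_conv_take_nth_drop)

text \<open>Mismatches are repaired one at a time by substitutions, each of which lowers their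
  number by one.\<close>

lemma ed_le_hamming:
  assumes "length x = length y"
  shows "ed x y \<le> card {p. p < length x \<and> x ! p \<noteq> y ! p}"
proof -
  have "(edit_step ^^ d) x y"
    if "length x = length y" "card {p. p < length x \<and> x ! p \<noteq> y ! p} = d" for x y :: "'a list" and d
    using that
  proof (induction d arbitrary: x)
    case 0
    then have "{p. p < length x \<and> x ! p \<noteq> y ! p} = {}" by simp
    then have "\<forall>p<length x. x ! p = y ! p" by blast
    with 0 show ?case by (simp add: list_eq_iff_nth_eq)
  next
    case (Suc d)
    then have "{p. p < length x \<and> x ! p \<noteq> y ! p} \<noteq> {}" by (metis card.empty nat.distinct(1))
    then obtain p where p: "p < length x" "x ! p \<noteq> y ! p" by blast
    let ?x = "x[p := y ! p]"
    have "{q. q < length ?x \<and> ?x ! q \<noteq> y ! q} = {q. q < length x \<and> x ! q \<noteq> y ! q} - {p}"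
      using p(1) by (auto simp: nth_list_update)
    then have "card {q. q < length ?x \<and> ?x ! q \<noteq> y ! q} = d"
      using Suc.prems p by (simp add: card_Diff_singleton)
    then have "(edit_step ^^ d) ?x y" using Suc.prems by (intro Suc.IH) auto
    then show ?case using edit_step_list_update[OF p(1)] by (rule relpowp_Suc_I2[rotated])
  qed
  then show ?thesis using assms by (intro ed_le) simp
qed

lemma edit_step_count_list:
  assumes "edit_step x y"
  shows "count_list x a \<le> Suc (count_list y a)"
  using assms by cases auto

text \<open>An insertion never lowers the count of \<open>a\<close>, a deletion shortens the string,
  and a substitution that lowers the count writes a letter other than \<open>a\<close>, so it
  creates no new \<open>a\<close>.\<close>

lemma edit_step_count_list_extremal:
  assumes "edit_step x y" "count_list x a = Suc (count_list y a)"
  shows "length y < length x \<or> length y = length x \<and> (\<forall>p<length x. y ! p = a \<longrightarrow> x ! p = a)"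
  using assms
  by cases (auto simp: nth_append nth_Cons' split: if_splits)

lemma edit_steps_count_list:
  assumes "(edit_step ^^ t) x y"
  shows "count_list x a \<le> count_list y a + t"
  using assms
proof (induction t arbitrary: x)
  case (Suc t)
  then obtain z where "edit_step x z" "(edit_step ^^ t) z y" by (meson relpowp_Suc_D2)
  then show ?case using Suc.IH[of z] edit_step_count_list[of x z a] by simp
qed simp

text \<open>If every step removes an occurrence of \<open>a\<close>, then no step is an insertion; as the length does
  not change, none is a deletion either, so every step substitutes another letter for an \<open>a\<close>.\<close>

lemma edit_steps_count_list_extremal:
  assumes "(edit_step ^^ t) x y" "count_list x a = count_list y a + t"
  shows "length y < length x \<or> length y = length x \<and> (\<forall>p<length x. y ! p = a \<longrightarrow> x ! p = a)"
  using assms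
proof (induction t arbitrary: x)
  case (Suc t)
  then obtain z where z: "edit_step x z" "(edit_step ^^ t) z y" by (meson relpowp_Suc_D2)
  have "count_list z a = count_list y a + t" "count_list x a = Suc (count_list z a)"
    using edit_steps_count_list[OF z(2), of a] edit_step_count_list[OF z(1), of a] Suc.prems(2)
    by simp_all
  then have "length y < length z \<or> length y = length z \<and> (\<forall>p<length z. y ! p = a \<longrightarrow> z ! p = a)"
    "length z < length x \<or> length z = length x \<and> (\<forall>p<length x. z ! p = a \<longrightarrow> x ! p = a)"
    using Suc.IH[OF z(2)] edit_step_count_list_extremal[OF z(1)] by blast+
  then show ?case by (elim disjE conjE) simp_all
qed simp

section \<open>Sets of positions encoded as two-letter strings\<close>

definition set_string :: "'a \<Rightarrow> 'a \<Rightarrow> nat \<Rightarrow> nat set \<Rightarrow> 'a list" where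
  "set_string a b n S = map (\<lambda>p. if p \<in> S then a else b) [0..<n]"

lemma length_set_string [simp]: "length (set_string a b n S) = n"
  by (simp add: set_string_def)

lemma nth_set_string [simp]:
  "p < n \<Longrightarrow> set_string a b n S ! p = (if p \<in> S then a else b)"
  by (simp add: set_string_def)

lemma set_string_in_nlists: "a \<in> \<Sigma> \<Longrightarrow> b \<in> \<Sigma> \<Longrightarrow> set_string a b n S \<in> nlists n \<Sigma>"
  by (intro nlistsI) (auto simp: set_string_def)

lemma count_list_set_string:
  assumes "a \<noteq> b" "S \<subseteq> {..<n}"
  shows "count_list (set_string a b n S) a = card S"
proof -
  have "count_list (set_string a b n S) a = card {p. p < n \<and> set_string a b n S ! p = a}"
    by (simp add: count_list_eq_length_filter length_filter_conv_card eq_commute[of a])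
  also have "{p. p < n \<and> set_string a b n S ! p = a} = S"
    using assms by (auto split: if_splits)
  finally show ?thesis .
qed

lemma ed_set_string_singleton:
  assumes "a \<noteq> b" "S \<subseteq> {..<n}" "q < n"
  shows "q \<in> S \<Longrightarrow> ed (set_string a b n S) (set_string a b n {q}) = card S - 1"
    and "q \<notin> S \<Longrightarrow> ed (set_string a b n S) (set_string a b n {q}) \<in> {card S..card S + 1}"
proof -
  let ?x = "set_string a b n S" and ?y = "set_string a b n {q}"
  have fin: "finite S" using assms finite_subset by blast
  have cx: "count_list ?x a = card S" and cy: "count_list ?y a = 1"
    using assms by (simp_all add: count_list_set_string)
  have lower: "card S \<le> 1 + ed ?x ?y"
    using edit_steps_count_list[OF ed_steps, of ?x a ?y] cx cy by simp
  have "{p. p < length ?x \<and> ?x ! p \<noteq> ?y ! p} = (if q \<in> S then S - {q} else insert q S)"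
    using assms by (auto split: if_splits)
  then have upper: "ed ?x ?y \<le> card (if q \<in> S then S - {q} else insert q S)"
    using ed_le_hamming[of ?x ?y] by simp
  show "ed ?x ?y = card S - 1" if "q \<in> S"
    using lower upper that fin by simp
  show "ed ?x ?y \<in> {card S..card S + 1}" if "q \<notin> S"
  proof -
    have "card S \<noteq> 1 + ed ?x ?y"
    proof
      assume "card S = 1 + ed ?x ?y"
      then have "\<forall>p<n. ?y ! p = a \<longrightarrow> ?x ! p = a"
        using edit_steps_count_list_extremal[OF ed_steps, of ?x a ?y] cx cy by simp
      then show False using assms that by force
    qed
    then show ?thesis using lower upper that fin by simp
  qed
qed

section \<open>Counting bound for the index problem\<close>

text \<open>Symmetric difference with \<open>w\<close> permutes \<open>Pow U\<close>, which reduces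
  the claim to \<open>w = {}\<close>; the sum is then the expansion of the product of
  \<open>1 / 2 + 1\<close> over \<open>U\<close>.\<close>

lemma sum_half_power_sym_diff:
  assumes "finite U" "w \<subseteq> U"
  shows "(\<Sum>x\<in>Pow U. (1 / 2 :: real) ^ card (sym_diff x w)) = (3 / 2) ^ card U"
proof -
  have "bij_betw (\<lambda>x. sym_diff x w) (Pow U) (Pow U)"
    by (rule bij_betwI[where g = "\<lambda>x. sym_diff x w"]) (use assms in auto)
  then have "(\<Sum>x\<in>Pow U. (1 / 2 :: real) ^ card (sym_diff x w)) = (\<Sum>x\<in>Pow U. (1 / 2) ^ card x)"
    by (rule sum.reindex_bij_betw)
  also have "\<dots> = (\<Prod>i\<in>U. 1 / 2 + 1)"
    using assms by (subst prod_add) auto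
  finally show ?thesis by simp
qed

text \<open>One-way complexity of the index problem. The argument compares the two sides of
  \<open>\<Sum>x. 2 powr - dist x (w (f x)) \<le> \<Sum>a\<in>A. \<Sum>x. 2 powr - dist x (w a)\<close>: the left-hand side is
  bounded below by convexity, the right-hand side equals \<open>card A * (3/2) ^ m\<close>.\<close>

lemma index_encoding_bound:
  fixes w :: "'b \<Rightarrow> nat set"
  assumes A: "finite A" "\<And>x. x \<subseteq> {..<m} \<Longrightarrow> f x \<in> A" "\<And>a. w a \<subseteq> {..<m}"
    and dist: "(\<Sum>x\<in>Pow {..<m}. real (card (sym_diff x (w (f x))))) \<le> 2 ^ m * (real m / 3)"
  shows "(32 / 27) ^ m \<le> real (card A) ^ 3"
proof -
  define X where "X = Pow {..<m}"
  define d where "d x a = card (sym_diff x (w a))" for x a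
  have cX: "real (card X) = 2 ^ m" and fX: "finite X" by (simp_all add: X_def card_Pow)
  \<comment> \<open>This prepares the tangent bound \<open>1 + t \<le> exp t\<close>: the mean
    distance is at most \<open>m / 3\<close>, so the terms with factor \<open>ln 2\<close> have a
    nonnegative sum.\<close>
  have "2 ^ m \<le> (\<Sum>x\<in>X. 1 + ln 2 * (real m / 3 - real (d x (f x))))"
    using dist cX
    by (simp add: sum.distrib sum_subtractf flip: sum_distrib_left) (simp add: X_def d_def)
  also have "\<dots> \<le> (\<Sum>x\<in>X. 2 powr (real m / 3) * (1 / 2) ^ d x (f x))"
  proof (rule sum_mono)
    fix x
    have "1 + ln 2 * (real m / 3 - real (d x (f x))) \<le> exp (ln 2 * (real m / 3 - real (d x (f x))))"
      by (rule exp_ge_add_one_self)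
    also have "\<dots> = 2 powr (real m / 3 - real (d x (f x)))"
      by (simp add: powr_def mult.commute)
    also have "\<dots> = 2 powr (real m / 3) * (1 / 2) ^ d x (f x)"
      by (simp add: powr_diff powr_realpow power_one_over)
    finally show "1 + ln 2 * (real m / 3 - real (d x (f x))) \<le> 2 powr (real m / 3) * (1 / 2) ^ d x (f x)" .
  qed
  \<comment> \<open>The old summand is the one for \<open>a = f x\<close>. Once \<open>f\<close> is
    gone, the two sums can be swapped.\<close>
  also have "\<dots> \<le> (\<Sum>x\<in>X. \<Sum>a\<in>A. 2 powr (real m / 3) * (1 / 2) ^ d x a)"
    using A by (intro sum_mono member_le_sum) (auto simp: X_def)
  also have "\<dots> = (\<Sum>a\<in>A. 2 powr (real m / 3) * (\<Sum>x\<in>X. (1 / 2) ^ d x a))"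
    by (subst sum.swap) (simp add: sum_distrib_left)
  also have "\<dots> = 2 powr (real m / 3) * (real (card A) * (3 / 2) ^ m)"
    unfolding X_def d_def using A by (simp add: sum_half_power_sym_diff)
  \<comment> \<open>Cubing turns \<open>2 powr (m / 3)\<close> into \<open>2 ^ m\<close>; the base
    left over is 8 / (2 * 27 / 8) = 32 / 27.\<close>
  finally have "(2 ^ m) ^ 3 \<le> (2 powr (real m / 3) * (real (card A) * (3 / 2) ^ m)) ^ 3"
    by (rule power_mono) simp
  moreover have "(2 powr (real m / 3)) ^ 3 = 2 ^ m"
    by (simp add: powr_power powr_realpow)
  moreover have "(c ^ 3) ^ m = (c ^ m) ^ 3" for c :: real
    by (simp only: mult.commute flip: power_mult)
  ultimately have "((2 :: real) ^ 3) ^ m \<le> 2 ^ m * (real (card A) ^ 3 * ((3 / 2) ^ 3) ^ m)"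
    by (simp only: power_mult_distrib)
  then have "(2 ^ 3) ^ m / (2 ^ m * ((3 / 2) ^ 3) ^ m) \<le> real (card A) ^ 3"
    by (simp add: field_simps)
  also have "(2 ^ 3) ^ m / (2 ^ m * ((3 / 2) ^ 3) ^ m) = (2 ^ 3 / (2 * (3 / 2) ^ 3) :: real) ^ m"
    by (simp only: power_divide power_mult_distrib)
  also have "2 ^ 3 / (2 * (3 / 2) ^ 3) = (32 / 27 :: real)" by (simp add: power_divide)
  finally show ?thesis .
qed

text \<open>Averaging: the number of events that hold has expectation at least
  \<open>p * card I\<close>, so it cannot stay below that value everywhere.\<close>

lemma (in prob_space) exists_outcome_many_events:
  assumes "finite I" "p > 0" "\<And>j. j \<in> I \<Longrightarrow> p \<le> \<P>(r in M. Q j r)"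
  shows "\<exists>r\<in>space M. p * card I \<le> card {j \<in> I. Q j r}"
proof (rule ccontr)
  let ?E = "\<lambda>j. {r \<in> space M. Q j r}"
  let ?X = "\<lambda>r. \<Sum>j\<in>I. indicat_real (?E j) r"
  assume contra: "\<not> ?thesis"
  \<comment> \<open>A non-measurable set would have measure 0, which is less than
    \<open>p\<close>.\<close>
  have ev: "?E j \<in> events" if "j \<in> I" for j
  proof (rule ccontr)
    assume "?E j \<notin> events"
    then have "\<P>(r in M. Q j r) = 0" by (rule measure_notin_sets)
    then show False using assms that by force
  qed
  have X: "?X r = card {j \<in> I. Q j r}" if "r \<in> space M" for r
    using assms(1) that by (simp add: indicator_def sum.If_cases Int_def)
  have int: "integrable M (indicat_real (?E j))" if "j \<in> I" for j
    using ev[OF that] by (rule integrable_real_indicator) (simp add: emeasure_eq_measure)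
  have "expectation ?X < p * card I"
  proof (rule expectation_less)
    show "integrable M ?X"  using int by (rule Bochner_Integration.integrable_sum)
    show "AE r in M. ?X r < p * card I" using contra X by (intro AE_I2) force
  qed
  moreover have "expectation ?X = (\<Sum>j\<in>I. \<P>(r in M. Q j r))"
    using int by (subst Bochner_Integration.integral_sum)
      (auto intro!: sum.cong arg_cong[where f = prob])
  moreover have "(\<Sum>j\<in>I. \<P>(r in M. Q j r)) \<ge> p * card I"
    using sum_mono[of I "\<lambda>_. p", OF assms(3)] by (simp add: mult.commute)
  ultimately show False by simp
qed

section \<open>From protocols to bounds on the sketch size\<close>

lemma length_le_sketch_size:
  assumes "sketch_size P \<Sigma> n = enat s" "r \<in> space (coins P)" "x \<in> nlists n \<Sigma>"
  shows "length (alice P r x) \<le> s" "length (bob P r x) \<le> s"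
proof -
  have "max (enat (length (alice P r x))) (enat (length (bob P r x))) \<le> sketch_size P \<Sigma> n"
    unfolding sketch_size_def using assms by (intro SUP_upper2[OF assms(2)] SUP_upper)
  then show "length (alice P r x) \<le> s" "length (bob P r x) \<le> s" using assms(1) by simp_all
qed

text \<open>With empty sketches the answer depends on \<open>r\<close> alone, yet Bob may hold
  Alice's own string or one at distance 1. Having \<open>1 \<le> s\<close> later absorbs additive
  constants into multiples of \<open>s\<close>.\<close>

lemma sketch_size_pos:
  assumes P: "computes_ed P \<Sigma> n k" and ab: "a \<in> \<Sigma>" "b \<in> \<Sigma>" "a \<noteq> b"
    and "0 < k" "0 < n" and s: "sketch_size P \<Sigma> n = enat s"
  shows "0 < s"
proof (rule ccontr)
  assume "\<not> 0 < s"
  interpret prob_space "coins P" using P by (simp add: computes_ed_def)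
  let ?x = "set_string a b n {}" and ?y = "set_string a b n {0}"
  have x: "?x \<in> nlists n \<Sigma>" and y: "?y \<in> nlists n \<Sigma>"
    using ab by (simp_all add: set_string_in_nlists)
  have "?x ! 0 \<noteq> ?y ! 0" using ab assms by simp
  then have "ed ?x ?y \<noteq> 0" using ed_steps[of ?x ?y] by (metis relpowp_0_E)
  moreover have "{p. p < length ?x \<and> ?x ! p \<noteq> ?y ! p} \<subseteq> {0}"
    by (auto split: if_splits)
  then have "card {p. p < length ?x \<and> ?x ! p \<noteq> ?y ! p} \<le> 1"
    using card_mono[of "{0 :: nat}"] by fastforce
  then have "ed ?x ?y \<le> 1" using ed_le_hamming[of ?x ?y] by simp
  ultimately have ed: "ed ?x ?y = 1" by simp
  define z where "z j = (if j then ?y else ?x)" for j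
  have z: "z j \<in> nlists n \<Sigma>" for j using x y by (simp add: z_def)
  have "2 / 3 \<le> \<P>(r in coins P. referee P r (alice P r ?x) (bob P r (z j)) = ed ?x (z j))" for j
    using P x z \<open>0 < k\<close> ed unfolding computes_ed_def by (simp add: z_def)
  \<comment> \<open>Since 2 * 2/3 exceeds 1, both answers must be correct at this
    \<open>r\<close>.\<close>
  then obtain r where r: "r \<in> space (coins P)"
    "2 / 3 * card (UNIV :: bool set)
      \<le> card {j \<in> UNIV. referee P r (alice P r ?x) (bob P r (z j)) = ed ?x (z j)}"
    using exists_outcome_many_events[of UNIV "2 / 3"
        "\<lambda>j r. referee P r (alice P r ?x) (bob P r (z j)) = ed ?x (z j)"] by auto
  let ?J = "{j \<in> UNIV. referee P r (alice P r ?x) (bob P r (z j)) = ed ?x (z j)}"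
  have bob: "bob P r (z j) = []" for j
    using length_le_sketch_size(2)[OF s r(1) z] \<open>\<not> 0 < s\<close> by simp
  have "ed ?x (z False) = 0" "ed ?x (z True) = 1" by (simp_all only: z_def if_True if_False ed ed_self)
  then have "\<not> (False \<in> ?J \<and> True \<in> ?J)" by (simp only: mem_Collect_eq bob) linarith
  then have "?J \<subset> UNIV" by blast
  then have "card ?J < card (UNIV :: bool set)" by (intro psubset_card_mono) simp_all
  then show False using r(2) by simp
qed

text \<open>Some outcome \<open>r\<close> suits two thirds of all pairs \<open>(x, i)\<close>. With
  it fixed, Alice's sketch determines a set that differs from \<open>x\<close> in at most
  \<open>m / 3\<close> elements on average, so many different sketches are needed.\<close>

lemma sketch_size_linear:
  assumes P: "computes_ed P \<Sigma> n k" and ab: "a \<in> \<Sigma>" "b \<in> \<Sigma>" "a \<noteq> b"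
    and m: "m + 1 \<le> k" "2 * m \<le> n" and s: "sketch_size P \<Sigma> n = enat s"
  shows "m \<le> 25 * s"
proof (cases "s = 0")
  case True
  then show ?thesis
    using sketch_size_pos[OF P ab _ _ s] m by (cases "n = 0") auto
next
  case False
  interpret prob_space "coins P" using P by (simp add: computes_ed_def)
  define S where "S x = x \<union> (+) m ` ({..<m} - x)" for x
  define xs where "xs x = set_string a b n (S x)" for x
  define ys where "ys i = set_string a b n {i}" for i
  have nl: "xs x \<in> nlists n \<Sigma>" "ys i \<in> nlists n \<Sigma>" for x i
    using ab by (simp_all add: xs_def ys_def set_string_in_nlists)
  have S: "S x \<subseteq> {..<n}" "card (S x) = m" "\<And>i. i < m \<Longrightarrow> i \<in> S x \<longleftrightarrow> i \<in> x" if "x \<subseteq> {..<m}" for x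
  proof -
    show "S x \<subseteq> {..<n}" "\<And>i. i < m \<Longrightarrow> i \<in> S x \<longleftrightarrow> i \<in> x" using that m by (auto simp: S_def)
    have "finite x" using that finite_subset by blast
    then have "card (S x) = card x + card ({..<m} - x)"
      unfolding S_def using that by (subst card_Un_disjoint) (auto simp: card_image)
    then show "card (S x) = m"
      using that \<open>finite x\<close> card_mono[OF _ that] by (simp add: card_Diff_subset)
  qed
  \<comment> \<open>The distance is \<open>m - 1\<close> if \<open>i \<in> x\<close>, and
    \<open>m\<close> or \<open>m + 1\<close> otherwise: comparison with \<open>m\<close> recovers
    the bit, and \<open>m + 1 \<le> k\<close> keeps every pair within the promise.\<close>
  have ed: "ed (xs x) (ys i) \<le> k" "ed (xs x) (ys i) < m \<longleftrightarrow> i \<in> x"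
    if "x \<subseteq> {..<m}" "i < m" for x i
    using ed_set_string_singleton[OF ab(3) S(1)[OF that(1)], of i] S(2,3)[OF that(1)] that m
    by (cases "i \<in> x"; simp add: xs_def ys_def)+
  define good where
    "good = (\<lambda>(x, i) r. referee P r (alice P r (xs x)) (bob P r (ys i)) = ed (xs x) (ys i))"
  let ?I = "Pow {..<m} \<times> {..<m}"
  have "2 / 3 \<le> \<P>(r in coins P. good j r)" if "j \<in> ?I" for j
    using P nl ed(1) that unfolding computes_ed_def good_def by (cases j) auto
  then obtain r where r: "r \<in> space (coins P)" "2 / 3 * card ?I \<le> card {j \<in> ?I. good j r}"
    using exists_outcome_many_events[of ?I "2 / 3" good] by auto
  \<comment> \<open>The set decoded from a sketch \<open>c\<close>, by running the referee against
    Bob's sketch of every index.\<close>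
  define w where "w c = {i. i < m \<and> referee P r c (bob P r (ys i)) < m}" for c
  define A where "A = {c :: bool list. length c \<le> s}"
  have fA: "finite A" and cA: "card A \<le> 4 ^ s"
  proof -
    have A: "A = {c. set c \<subseteq> UNIV \<and> length c \<le> s}" by (simp add: A_def)
    show "finite A" unfolding A by (rule finite_lists_length_le) simp
    have "card A = (\<Sum>i\<le>s. 2 ^ i)"
      unfolding A by (subst card_lists_length_le) auto
    also have "\<dots> < 2 ^ (s + 1)"
      using sum_power2[of "Suc s"] by (simp add: lessThan_Suc_atMost atLeast0LessThan)
    also have "(2 :: nat) ^ (s + 1) \<le> 2 ^ (2 * s)" using False by (intro power_increasing) auto
    finally show "card A \<le> 4 ^ s" by (simp add: power_mult)
  qed
  let ?f = "\<lambda>x. alice P r (xs x)"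
  have "(\<Sum>x\<in>Pow {..<m}. card (sym_diff x (w (?f x)))) =
      card (SIGMA x:Pow {..<m}. sym_diff x (w (?f x)))"
    by (rule card_SigmaI[symmetric]) (auto simp: w_def intro: finite_subset)
  also have "\<dots> \<le> card (?I - {j \<in> ?I. good j r})"
  proof (rule card_mono)
    \<comment> \<open>Each wrongly decoded bit comes from a pair on which the referee errs.\<close>
    show "(SIGMA x:Pow {..<m}. sym_diff x (w (?f x))) \<subseteq> ?I - {j \<in> ?I. good j r}"
    proof
      fix j assume "j \<in> (SIGMA x:Pow {..<m}. sym_diff x (w (?f x)))"
      then obtain x i where j: "j = (x, i)" "x \<subseteq> {..<m}" "i \<in> sym_diff x (w (?f x))" by auto
      then have "i < m" by (auto simp: w_def)
      then show "j \<in> ?I - {j \<in> ?I. good j r}"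
        using j ed(2)[of x i] by (auto simp: w_def good_def)
    qed
  qed simp
  also have "\<dots> = card ?I - card {j \<in> ?I. good j r}"
    by (rule card_Diff_subset) auto
  finally have "real (\<Sum>x\<in>Pow {..<m}. card (sym_diff x (w (?f x)))) \<le> real (card ?I) / 3"
    using r(2) by linarith
  then have "(32 / 27) ^ m \<le> real (card A) ^ 3"
    using fA length_le_sketch_size(1)[OF s r(1) nl(1)]
    by (intro index_encoding_bound[where w = w and f = ?f])
      (auto simp: A_def w_def card_Pow card_cartesian_product)
  also have "\<dots> \<le> (4 ^ s) ^ 3" using cA by (intro power_mono) (simp_all flip: of_nat_le_iff)
  also have "\<dots> = (4 ^ 3 :: real) ^ s" by (simp only: mult.commute flip: power_mult)
  \<comment> \<open>25 is the least exponent for which the power of 32 / 27 reaches 64.\<close>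
  also have "\<dots> \<le> ((32 / 27) ^ 25) ^ s" by (rule power_mono) (simp_all add: power_divide)
  finally have "(32 / 27 :: real) ^ m \<le> (32 / 27) ^ (25 * s)" by (simp add: power_mult)
  then show ?thesis by (rule power_le_imp_le_exp[rotated]) simp
qed

theorem theoremB2:
  fixes C :: real
  shows "\<exists>c>0. \<forall>(\<Sigma> :: 'a set) (n :: nat) (k :: nat) (P :: ('r, 'a) sketch_protocol).
    finite \<Sigma> \<longrightarrow>
    (real k \<le> C * sqrt (real n) \<and> 2 \<le> card \<Sigma>) \<or> (real k \<le> C * real n \<and> 2 * n \<le> card \<Sigma>) \<longrightarrow>
    computes_ed P \<Sigma> n k \<longrightarrow>
    ereal (c * real k) \<le> ereal_of_enat (sketch_size P \<Sigma> n)"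
proof (intro exI[of _ "1 / (26 + 51 * \<bar>C\<bar>)"] conjI allI impI)
  \<comment> \<open>26 comes from \<open>k \<le> 25 * s + 1\<close>, and 51 from
    \<open>n \<le> 2 * (25 * s) + 1\<close>, both with \<open>1 \<le> s\<close>.\<close>
  let ?K = "26 + 51 * \<bar>C\<bar>"
  show "0 < 1 / ?K" by simp
  fix \<Sigma> :: "'a set" and n k :: nat and P :: "('r, 'a) sketch_protocol"
  assume hyp: "(real k \<le> C * sqrt (real n) \<and> 2 \<le> card \<Sigma>) \<or>
      (real k \<le> C * real n \<and> 2 * n \<le> card \<Sigma>)"
    and P: "computes_ed P \<Sigma> n k"
  show "ereal (1 / ?K * real k) \<le> ereal_of_enat (sketch_size P \<Sigma> n)"
  proof (cases "k = 0 \<or> sketch_size P \<Sigma> n = \<infinity>")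
    case True
    then show ?thesis by (elim disjE) (simp_all flip: zero_ereal_def)
  next
    case False
    then obtain s where k: "0 < k" and s: "sketch_size P \<Sigma> n = enat s" by auto
    have n: "0 < n" using hyp k by (cases "n = 0") auto
    \<comment> \<open>Both regimes are merged into \<open>k \<le> \<bar>C\<bar> * n\<close> over at
      least two letters.\<close>
    have "sqrt (real n) \<le> real n"
      using n by (intro real_le_lsqrt) (auto simp: power2_eq_square)
    then have "C * sqrt (real n) \<le> \<bar>C\<bar> * real n" by (intro mult_mono) auto
    moreover have "C * real n \<le> \<bar>C\<bar> * real n" by (intro mult_right_mono) auto
    ultimately have kn: "real k \<le> \<bar>C\<bar> * real n" using hyp by linarith
    have "2 \<le> card \<Sigma>" using hyp n by linarith
    then obtain T where "T \<subseteq> \<Sigma>" "card T = 2" by (meson obtain_subset_with_card_n)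
    then obtain a b where ab: "a \<in> \<Sigma>" "b \<in> \<Sigma>" "a \<noteq> b"
      by (auto simp: card_2_iff)
    have s1: "1 \<le> s" using sketch_size_pos[OF P ab k n s] by simp
    \<comment> \<open>The largest \<open>m\<close> with \<open>m + 1 \<le> k\<close> and
      \<open>2 * m \<le> n\<close>.\<close>
    let ?m = "min (k - 1) (n div 2)"
    have m: "?m \<le> 25 * s" using k by (intro sketch_size_linear[OF P ab _ _ s]) auto
    have "real k \<le> ?K * real s"
    proof (cases "k - 1 \<le> n div 2")
      case True
      then have "real k \<le> 26 * real s" using m s1 by simp
      then show ?thesis by (simp add: distrib_right add_increasing2)
    next
      case False
      then have "real n \<le> 51 * real s" using m s1 by simp
      then have "\<bar>C\<bar> * real n \<le> \<bar>C\<bar> * (51 * real s)" by (intro mult_left_mono) auto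
      then show ?thesis using kn by (simp add: distrib_right)
    qed
    then show ?thesis by (simp add: s field_simps)
  qed
qed

end
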